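(* Let $(X,\mathcal{R})$, $\mathcal{R}=\{R_0,\ldots,R_s\}$, be a symmetric association scheme with $s$ classes, let $I\subset[s]=\{1,\ldots,s\}$ be a nonempty index set, and let $G_I=(X,R_I)$ be the graph with edge set $R_I=\bigcup_{i\in I}R_i$, assumed connected. If $Y\subset X$ is a $k$-graphical design on $G_I$, then $Y$ is a $T$-design for some $T\subseteq[s]$ with $|T|\ge k-1$.
   Context: A symmetric association scheme with $s$ classes is a finite set $X$ with relations $R_0,\ldots,R_s$ on $X$ such that: each $R_i$ is symmetric; every pair $(x,y)\in X\times X$ lies in exactly one $R_i$; $R_0=\{(x,x):x\in X\}$; and for $(x,y)\in R_q$ the number of $z$ with $(x,z)\in R_i$ and $(y,z)\in R_j$ is a constant depending only on $i,j,q$. Let $A_i$ be the $0/1$ matrix of $R_i$. The span of $A_0,\ldots,A_s$ over $\mathbb{R}$ is a commutative algebra with a unique basis of primitive idempotents $J_0,\ldots,J_s$ (symmetric, $J_i^2=J_i$, $J_iJ_j=0$ for $i\ne j$, $\sum_iJ_i=I$), with $J_0=\frac{1}{|X|}$ times the all-ones matrix. For $T\subseteq[s]$, a $T$-design is a nonempty $Y\subset X$ with $J_i\mathbf{1}_Y=0$ for all $i\in T$, where $\mathbf{1}_Y$ is the indicator vector of $Y$. For a connected graph $G=(V,E)$ with adjacency matrix $A$ and diagonal degree matrix $D$, $L=AD^{-1}-I$. A nonempty $W\subset V$ integrates $\phi:V\to\mathbb{R}$ if $\frac{1}{|W|}\sum_{w\in W}\phi(w)=\frac{1}{|V|}\sum_{v\in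 V}\phi(v)$, and integrates an eigenspace of $L$ if it integrates every eigenvector in a basis of it. The frequency ordering of a regular graph lists its distinct eigenspaces of $L$ in order of nonincreasing $|\lambda+1|$ ($\lambda$ the eigenvalue), with the eigenspace of eigenvalue $0$ first; other ties may be broken arbitrarily. $W$ is a $k$-graphical design if it integrates the first $k$ eigenspaces in some such ordering. *)

theory Defs
  imports "HOL-Analysis.Analysis"
begin

text \<open>The finite ground set (the points of a scheme, the vertices of a graph) is the universe of a
  type of class \<open>finite\<close>, so that functions and square matrices on it are the library's vectors
  \<open>real ^ 'x\<close> and matrices \<open>real ^ 'x ^ 'x\<close>.\<close>

definition indicator_vec :: "'x set \<Rightarrow> real ^ 'x::finite" where
  "indicator_vec Y = (\<chi> x. indicator Y x)"

definition relation_matrix :: "('x \<times> 'x) set \<Rightarrow> real ^ 'x ^ 'x::finite" where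
  "relation_matrix E = (\<chi> x y. if (x, y) \<in> E then 1 else 0)"


subsection \<open>Symmetric association schemes\<close>

definition symmetric_association_scheme :: "nat \<Rightarrow> (nat \<Rightarrow> ('x::finite \<times> 'x) set) \<Rightarrow> bool" where
  "symmetric_association_scheme s R \<longleftrightarrow>
     (\<forall>i\<le>s. sym (R i)) \<and>
     (\<forall>x y. \<exists>!i. i \<le> s \<and> (x, y) \<in> R i) \<and>
     R 0 = Id \<and>
     (\<forall>i\<le>s. \<forall>j\<le>s. \<forall>q\<le>s. \<exists>p::nat. \<forall>(x, y)\<in>R q. card {z. (x, z) \<in> R i \<and> (y, z) \<in> R j} = p)"

definition scheme_algebra :: "nat \<Rightarrow> (nat \<Rightarrow> ('x::finite \<times> 'x) set) \<Rightarrow> (real ^ 'x ^ 'x) set" where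
  "scheme_algebra s R = span ((\<lambda>i. relation_matrix (R i)) ` {0..s})"

definition primitive_idempotent :: "(real ^ 'x ^ 'x::finite) set \<Rightarrow> real ^ 'x ^ 'x \<Rightarrow> bool" where
  "primitive_idempotent \<A> E \<longleftrightarrow>
     E \<in> \<A> \<and> E \<noteq> 0 \<and> E ** E = E \<and>
     (\<forall>F\<in>\<A>. F ** F = F \<and> E ** F = F \<and> F ** E = F \<longrightarrow> F = 0 \<or> F = E)"

text \<open>The primitive idempotents of the algebra are unique as a set; apart from the convention for
  \<open>J 0\<close> their numbering is arbitrary, so \<open>J\<close> ranges over all such numberings. As they form a basis
  indexed by \<open>{0..s}\<close>, the \<open>s + 1\<close> relations are necessarily nonempty.\<close>

definition primitive_idempotent_basis ::
    "nat \<Rightarrow> (nat \<Rightarrow> ('x::finite \<times> 'x) set) \<Rightarrow> (nat \<Rightarrow> real ^ 'x ^ 'x) \<Rightarrow> bool" where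
  "primitive_idempotent_basis s R J \<longleftrightarrow>
     inj_on J {0..s} \<and> independent (J ` {0..s}) \<and> span (J ` {0..s}) = scheme_algebra s R \<and>
     (\<forall>i\<le>s. primitive_idempotent (scheme_algebra s R) (J i)) \<and>
     (\<forall>i\<le>s. transpose (J i) = J i) \<and>
     (\<forall>i\<le>s. \<forall>j\<le>s. i \<noteq> j \<longrightarrow> J i ** J j = 0) \<and>
     (\<Sum>i=0..s. J i) = mat 1 \<and>
     J 0 = (\<chi> x y. 1 / real CARD('x))"

definition T_design ::
    "nat \<Rightarrow> (nat \<Rightarrow> real ^ 'x ^ 'x::finite) \<Rightarrow> nat set \<Rightarrow> 'x set \<Rightarrow> bool" where
  "T_design s J T Y \<longleftrightarrow>
     T \<subseteq> {1..s} \<and> Y \<noteq> {} \<and> (\<forall>i\<in>T. J i *v indicator_vec Y = 0)"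


subsection \<open>Graphical designs\<close>

text \<open>A graph on the whole type is given by its symmetric set \<open>E\<close> of adjacent ordered pairs.\<close>

definition graph_connected :: "('v \<times> 'v) set \<Rightarrow> bool" where
  "graph_connected E \<longleftrightarrow> (\<forall>u v. (u, v) \<in> E\<^sup>*)"

definition degree_matrix :: "('v \<times> 'v) set \<Rightarrow> real ^ 'v ^ 'v::finite" where
  "degree_matrix E = (\<chi> u v. if u = v then real (card {w. (u, w) \<in> E}) else 0)"

definition laplacian :: "('v \<times> 'v) set \<Rightarrow> real ^ 'v ^ 'v::finite" where
  "laplacian E = relation_matrix E ** matrix_inv (degree_matrix E) - mat 1"

definition eigenspace :: "real ^ 'v ^ 'v \<Rightarrow> real \<Rightarrow> (real ^ 'v::finite) set" where
  "eigenspace M \<mu> = {\<phi>. M *v \<phi> = \<mu> *\<^sub>R \<phi>}"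

definition eigenvalue :: "real ^ 'v ^ 'v::finite \<Rightarrow> real \<Rightarrow> bool" where
  "eigenvalue M \<mu> \<longleftrightarrow> (\<exists>\<phi>. \<phi> \<noteq> 0 \<and> M *v \<phi> = \<mu> *\<^sub>R \<phi>)"

definition integrates :: "'v set \<Rightarrow> real ^ 'v::finite \<Rightarrow> bool" where
  "integrates W \<phi> \<longleftrightarrow>
     1 / real (card W) * (\<Sum>w\<in>W. \<phi> $ w) = 1 / real CARD('v) * (\<Sum>v\<in>UNIV. \<phi> $ v)"

definition integrates_space :: "'v set \<Rightarrow> (real ^ 'v::finite) set \<Rightarrow> bool" where
  "integrates_space W S \<longleftrightarrow>
     (\<exists>B. B \<subseteq> S \<and> independent B \<and> span B = S \<and> (\<forall>\<phi>\<in>B. integrates W \<phi>))"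

text \<open>Distinct eigenspaces are listed through their eigenvalues. Only the first position is
  prescribed among equal values of \<open>\<bar>\<mu> + 1\<bar>\<close>.\<close>

definition frequency_ordering :: "('v::finite \<times> 'v) set \<Rightarrow> real list \<Rightarrow> bool" where
  "frequency_ordering E ls \<longleftrightarrow>
     distinct ls \<and> set ls = {\<mu>. eigenvalue (laplacian E) \<mu>} \<and>
     ls \<noteq> [] \<and> hd ls = 0 \<and> sorted_wrt (\<lambda>a b. \<bar>a + 1\<bar> \<ge> \<bar>b + 1\<bar>) (tl ls)"

definition graphical_design :: "('v::finite \<times> 'v) set \<Rightarrow> nat \<Rightarrow> 'v set \<Rightarrow> bool" where
  "graphical_design E k W \<longleftrightarrow>
     W \<noteq> {} \<and>
     (\<exists>ls. frequency_ordering E ls \<and> k \<le> length ls \<and>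
           (\<forall>i<k. integrates_space W (eigenspace (laplacian E) (ls ! i))))"

end

theory Submission
  imports Defs
begin

text \<open>
  The graph \<open>G\<close> on the union of the relations indexed by \<open>I\<close> is regular, because every relation of
  the scheme is. So its Laplacian \<open>L\<close> is a linear combination of the identity and the adjacency
  matrix of \<open>G\<close>, and therefore lies in the scheme algebra
  (\<open>laplacian_in_scheme_algebra\<close>). Every element of that algebra multiplies each primitive
  idempotent by a scalar (\<open>scheme_algebra_mult_idempotent\<close>), say \<open>L J\<^sub>i = c\<^sub>i J\<^sub>i\<close>. Two
  consequences follow.

  First, the columns of \<open>J\<^sub>i\<close> lie in the eigenspace of \<open>L\<close> for \<open>c\<^sub>i\<close>, and for \<open>i \<noteq> 0\<close> their
  entries sum to zero, as \<open>J\<^sub>0 J\<^sub>i = 0\<close>. If \<open>Y\<close> integrates that eigenspace, then all columns of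
  \<open>J\<^sub>i\<close> sum to zero over \<open>Y\<close>, and by the symmetry of \<open>J\<^sub>i\<close> this says that \<open>J\<^sub>i\<close> annihilates the
  indicator vector of \<open>Y\<close> (\<open>idempotent_annihilates_indicator\<close>).

  Second, since the \<open>J\<^sub>i\<close> sum to the identity, every eigenvalue of \<open>L\<close> is one of the \<open>c\<^sub>i\<close>
  (\<open>eigenvalue_of_resolution\<close>). The \<open>k\<close> distinct eigenvalues whose eigenspaces \<open>Y\<close> integrates thus
  come from at least \<open>k\<close> indices \<open>i\<close>, of which at least \<open>k - 1\<close> differ from \<open>0\<close>. These form \<open>T\<close>.
\<close>

section \<open>Linearity of integration\<close>

lemma subspace_integrates: "subspace {\<phi>. integrates W \<phi>}"
proof -
  have "linear (\<lambda>\<phi>. 1 / real (card W) * (\<Sum>w\<in>W. \<phi> $ w)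
                     - 1 / real CARD('v) * (\<Sum>v\<in>UNIV. \<phi> $ v))"
    for W :: "'v::finite set"
    by (rule linearI)
       (simp_all add: sum.distrib sum_distrib_left[symmetric] algebra_simps)
  from linear_subspace_kernel[OF this, of W] show ?thesis
    by (simp add: integrates_def)
qed

text \<open>Integration of an eigenspace is tested on one basis only, but extends to the whole space by
  linearity.\<close>

lemma integrates_space_imp_integrates:
  assumes "integrates_space W S" and "\<phi> \<in> S"
  shows "integrates W \<phi>"
proof -
  obtain B where B: "span B = S" "\<forall>\<phi>\<in>B. integrates W \<phi>"
    using assms(1) by (auto simp: integrates_space_def)
  have "span B \<subseteq> {\<phi>. integrates W \<phi>}"
    using B(2) by (intro span_minimal subspace_integrates) auto
  with B(1) assms(2) show ?thesis by auto
qed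

section \<open>The Laplacian in the scheme algebra\<close>

lemma scheme_relation_unique:
  assumes "symmetric_association_scheme s R" and "i \<le> s" and "j \<le> s"
    and "(x, y) \<in> R i" and "(x, y) \<in> R j"
  shows "i = j"
proof -
  have "\<exists>!i. i \<le> s \<and> (x, y) \<in> R i"
    using assms(1) by (simp add: symmetric_association_scheme_def)
  with assms(2-5) show ?thesis by blast
qed

text \<open>The valency of \<open>R i\<close> is the intersection number counting the points \<open>z\<close> that are related by
  \<open>R i\<close> to both entries of a diagonal pair.\<close>

lemma scheme_relation_regular:
  assumes "symmetric_association_scheme s R" and "i \<le> s"
  obtains d where "\<And>x. card {z. (x, z) \<in> R i} = d"
proof -
  have "\<exists>p::nat. \<forall>(x, y)\<in>R 0. card {z. (x, z) \<in> R i \<and> (y, z) \<in> R i} = p"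
    and "R 0 = Id"
    using assms unfolding symmetric_association_scheme_def by (blast, blast)
  then obtain p where "\<forall>(x, y)\<in>Id. card {z. (x, z) \<in> R i \<and> (y, z) \<in> R i} = p" by auto
  from bspec[OF this IdI] show ?thesis by (intro that[of p]) simp
qed

lemma degree_matrix_scheme_union:
  assumes sch: "symmetric_association_scheme s R" and I: "I \<subseteq> {0..s}"
  obtains d where "degree_matrix (\<Union>i\<in>I. R i) = d *\<^sub>R mat 1"
proof -
  have "\<exists>d. \<forall>x. card {z. (x, z) \<in> R i} = d" if "i \<in> I" for i
  proof -
    have "i \<le> s" using that I by auto
    then show ?thesis by (metis scheme_relation_regular[OF sch])
  qed
  then obtain d where d: "card {z. (x, z) \<in> R i} = d i" if "i \<in> I" for i x
    by metis
  have fin: "finite I" using I finite_subset by blast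
  have "card {z. (x, z) \<in> (\<Union>i\<in>I. R i)} = sum d I" for x
  proof -
    have "{z. (x, z) \<in> (\<Union>i\<in>I. R i)} = (\<Union>i\<in>I. {z. (x, z) \<in> R i})" by auto
    also have "card \<dots> = (\<Sum>i\<in>I. card {z. (x, z) \<in> R i})"
    proof (rule card_UN_disjoint[OF fin])
      show "\<forall>i\<in>I. \<forall>j\<in>I. i \<noteq> j \<longrightarrow> {z. (x, z) \<in> R i} \<inter> {z. (x, z) \<in> R j} = {}"
      proof (intro ballI impI)
        fix i j assume "i \<in> I" "j \<in> I" "i \<noteq> j"
        then have "i \<le> s" "j \<le> s" using I by auto
        with \<open>i \<noteq> j\<close> show "{z. (x, z) \<in> R i} \<inter> {z. (x, z) \<in> R j} = {}"
          using scheme_relation_unique[OF sch] by blast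
      qed
    qed simp
    finally show ?thesis using d by simp
  qed
  then have "degree_matrix (\<Union>i\<in>I. R i) = real (sum d I) *\<^sub>R mat 1"
    by (simp add: degree_matrix_def mat_def vec_eq_iff)
  with that show ?thesis .
qed

lemma relation_matrix_scheme_union:
  assumes sch: "symmetric_association_scheme s R" and I: "I \<subseteq> {0..s}"
  shows "relation_matrix (\<Union>i\<in>I. R i) = (\<Sum>i\<in>I. relation_matrix (R i))"
proof -
  have fin: "finite I" using I finite_subset by blast
  have "(if (x, y) \<in> (\<Union>i\<in>I. R i) then 1 else 0) = (\<Sum>i\<in>I. if (x, y) \<in> R i then 1 else (0::real))"
    for x y
  proof (cases "(x, y) \<in> (\<Union>i\<in>I. R i)")
    case True
    then obtain j where j: "j \<in> I" "(x, y) \<in> R j" by auto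
    have "(x, y) \<in> R i \<longleftrightarrow> i = j" if "i \<in> I" for i
    proof -
      have "i \<le> s" "j \<le> s" using that j(1) I by auto
      with j(2) show ?thesis using scheme_relation_unique[OF sch] by blast
    qed
    then have "(\<Sum>i\<in>I. if (x, y) \<in> R i then 1 else (0::real)) = (\<Sum>i\<in>I. if i = j then 1 else 0)"
      by (intro sum.cong) auto
    with True fin j show ?thesis by simp
  qed auto
  then show ?thesis by (simp add: relation_matrix_def vec_eq_iff)
qed

lemma laplacian_in_scheme_algebra:
  fixes R :: "nat \<Rightarrow> ('x::finite \<times> 'x) set"
  assumes sch: "symmetric_association_scheme s R" and I: "I \<subseteq> {0..s}"
  shows "laplacian (\<Union>i\<in>I. R i) \<in> scheme_algebra s R"
proof -
  let ?E = "\<Union>i\<in>I. R i"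
  have one: "mat 1 \<in> scheme_algebra s R"
  proof -
    have "R 0 = Id" using sch by (simp add: symmetric_association_scheme_def)
    then have "mat 1 = relation_matrix (R 0)"
      by (simp add: relation_matrix_def mat_def vec_eq_iff)
    then show ?thesis by (simp add: scheme_algebra_def span_base)
  qed
  have A: "relation_matrix ?E \<in> scheme_algebra s R"
    unfolding relation_matrix_scheme_union[OF sch I] scheme_algebra_def
    using I by (intro span_sum span_base) auto
  obtain d where d: "degree_matrix ?E = d *\<^sub>R mat 1"
    using degree_matrix_scheme_union[OF sch I] .
  have "\<exists>c. relation_matrix ?E ** matrix_inv (degree_matrix ?E) = c *\<^sub>R relation_matrix ?E"
    (is "\<exists>c. ?P c")
  proof (cases "d = 0")
    \<comment> \<open>The inverse of the zero matrix is unspecified, but a graph without edges has a vanishing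
        adjacency matrix, so the product is zero nonetheless.\<close>
    case True
    have "real (card {w. (u, w) \<in> ?E}) = degree_matrix ?E $ u $ u" for u
      by (simp add: degree_matrix_def)
    then have "{w. (u, w) \<in> ?E} = {}" for u
      unfolding d True by simp
    then have "relation_matrix ?E = 0"
      by (auto simp: relation_matrix_def vec_eq_iff)
    then show ?thesis by simp
  next
    case False
    have "d *\<^sub>R mat 1 ** ((1 / d) *\<^sub>R mat 1) = (mat 1 :: real ^ 'x ^ 'x)"
      and "(1 / d) *\<^sub>R mat 1 ** (d *\<^sub>R mat 1) = (mat 1 :: real ^ 'x ^ 'x)"
      using False by (simp_all add: scalar_matrix_assoc[symmetric] matrix_scalar_ac)
    then have "\<exists>B. degree_matrix ?E ** B = mat 1 \<and> B ** degree_matrix ?E = mat 1"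
      unfolding d by blast
    then have "degree_matrix ?E ** matrix_inv (degree_matrix ?E) = mat 1"
      unfolding matrix_inv_def by (rule someI2_ex) blast
    then have "d *\<^sub>R matrix_inv (degree_matrix ?E) = mat 1"
      by (simp add: d scalar_matrix_assoc[symmetric])
    then have "(1 / d) *\<^sub>R (d *\<^sub>R matrix_inv (degree_matrix ?E)) = (1 / d) *\<^sub>R mat 1"
      by (rule arg_cong)
    then have "matrix_inv (degree_matrix ?E) = (1 / d) *\<^sub>R mat 1"
      using False by simp
    then show ?thesis by (auto simp: matrix_scalar_ac scalar_matrix_assoc[symmetric])
  qed
  then obtain c where "?P c" by blast
  then have "laplacian ?E = c *\<^sub>R relation_matrix ?E - mat 1"
    by (simp add: laplacian_def)
  with one A show ?thesis
    unfolding scheme_algebra_def by (metis span_diff span_scale)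
qed

section \<open>Idempotents and eigenspaces\<close>

lemma matrix_add_rdistrib:
  fixes A B :: "'a::semiring_1 ^ 'n ^ 'm"
  shows "(A + B) ** C = A ** C + B ** C"
  by (simp add: matrix_matrix_mult_def vec_eq_iff distrib_right sum.distrib)

text \<open>The idempotents are orthogonal, so in the basis that they form multiplication is
  coordinatewise.\<close>

lemma scheme_algebra_mult_idempotent:
  assumes J: "primitive_idempotent_basis s R J" and M: "M \<in> scheme_algebra s R" and i: "i \<le> s"
  shows "\<exists>c. M ** J i = c *\<^sub>R J i \<and> J i ** M = c *\<^sub>R J i"
proof -
  have idem: "J i ** J i = J i"
    using J i by (simp add: primitive_idempotent_basis_def primitive_idempotent_def)
  have orth: "J j ** J i = 0" "J i ** J j = 0" if "j \<le> s" "j \<noteq> i" for j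
    using J i that by (simp_all add: primitive_idempotent_basis_def)
  have "M \<in> span (J ` {0..s})"
    using J M by (simp add: primitive_idempotent_basis_def)
  then show ?thesis
  proof (induction rule: span_induct_alt)
    case base
    show ?case by (intro exI[of _ 0]) simp
  next
    case (step a N K)
    obtain j where j: "j \<le> s" "N = J j" using step(1) by auto
    obtain c where c: "K ** J i = c *\<^sub>R J i" "J i ** K = c *\<^sub>R J i" using step(2) by blast
    show ?case
      using j c idem orth
      by (intro exI[of _ "(if j = i then a else 0) + c"])
         (auto simp: matrix_add_ldistrib matrix_add_rdistrib scalar_matrix_assoc[symmetric]
            matrix_scalar_ac scaleR_add_left)
  qed
qed

text \<open>The components \<open>J i *v \<phi>\<close> of an eigenvector \<open>\<phi>\<close> sum to \<open>\<phi>\<close>, so one of them is nonzero. For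
  that \<open>i\<close>, evaluating \<open>J i ** M\<close> at \<open>\<phi>\<close> in two ways gives \<open>\<mu> = c i\<close>.\<close>

lemma eigenvalue_of_resolution:
  fixes J :: "'i \<Rightarrow> real ^ 'n ^ 'n::finite"
  assumes res: "(\<Sum>i\<in>S. J i) = mat 1" and act: "\<And>i. i \<in> S \<Longrightarrow> J i ** M = c i *\<^sub>R J i"
    and ev: "eigenvalue M \<mu>"
  shows "\<mu> \<in> c ` S"
proof -
  obtain \<phi> where \<phi>: "\<phi> \<noteq> 0" "M *v \<phi> = \<mu> *\<^sub>R \<phi>"
    using ev by (auto simp: eigenvalue_def)
  have "(\<Sum>i\<in>S. J i *v \<phi>) = (\<Sum>i\<in>S. J i) *v \<phi>"
    by (induction S rule: infinite_finite_induct) (simp_all add: matrix_vector_mult_add_rdistrib)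
  then have "(\<Sum>i\<in>S. J i *v \<phi>) \<noteq> 0"
    using res \<phi>(1) by simp
  then obtain i where i: "i \<in> S" "J i *v \<phi> \<noteq> 0"
    by (meson sum.neutral)
  have "c i *\<^sub>R (J i *v \<phi>) = (J i ** M) *v \<phi>"
    using act[OF i(1)] by (simp add: scaleR_matrix_vector_assoc)
  also have "\<dots> = \<mu> *\<^sub>R (J i *v \<phi>)"
    by (simp add: matrix_vector_mul_assoc[symmetric] \<phi>(2) matrix_vector_mult_scaleR)
  finally show ?thesis using i by auto
qed

text \<open>Each column of \<open>J i\<close> lies in the eigenspace that \<open>Y\<close> integrates, and its average over all
  points vanishes by orthogonality to \<open>J 0\<close>, so its average over \<open>Y\<close> vanishes too. By symmetry the sum of a column over \<open>Y\<close> is an entry of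
  \<open>J i *v indicator_vec Y\<close>.\<close>

lemma idempotent_annihilates_indicator:
  fixes J :: "nat \<Rightarrow> real ^ 'x ^ 'x::finite"
  assumes J: "primitive_idempotent_basis s R J" and i: "i \<in> {1..s}" and Y: "Y \<noteq> {}"
    and act: "L ** J i = c *\<^sub>R J i" and int: "integrates_space Y (eigenspace L c)"
  shows "J i *v indicator_vec Y = 0"
proof -
  have J0: "J 0 = (\<chi> x y. 1 / real CARD('x))" and "J 0 ** J i = 0" and tr: "transpose (J i) = J i"
    using J i by (auto simp: primitive_idempotent_basis_def)
  have sum_Y: "(\<Sum>y\<in>Y. J i $ y $ x) = 0" for x
  proof -
    let ?\<phi> = "column x (J i)"
    have col: "?\<phi> = J i *v axis x 1" by (simp add: matrix_vector_mul_component matrix_vector_mult_basis)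
    have "L *v ?\<phi> = c *\<^sub>R ?\<phi>"
      unfolding col using act
      by (simp add: matrix_vector_mul_assoc scaleR_matrix_vector_assoc)
    then have "integrates Y ?\<phi>"
      using integrates_space_imp_integrates[OF int] by (simp add: eigenspace_def)
    \<comment> \<open>All entries of \<open>J 0\<close> equal \<open>1 / CARD('x)\<close>, so multiplying by \<open>J 0\<close> averages columns.\<close>
    moreover have "1 / real CARD('x) * (\<Sum>v\<in>UNIV. ?\<phi> $ v) = (J 0 ** J i) $ x $ x"
      by (simp add: J0 matrix_matrix_mult_def column_def sum_distrib_left)
    ultimately show ?thesis
      using \<open>J 0 ** J i = 0\<close> Y by (simp add: integrates_def column_def)
  qed
  have "(J i *v indicator_vec Y) $ x = 0" for x
  proof -
    have "(J i *v indicator_vec Y) $ x = (\<Sum>y\<in>UNIV. J i $ x $ y * indicator Y y)"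
      by (simp add: matrix_vector_mult_def indicator_vec_def)
    also have "\<dots> = (\<Sum>y\<in>Y. J i $ x $ y)"
      by simp
    also have "\<dots> = (\<Sum>y\<in>Y. J i $ y $ x)"
      using tr by (metis transpose_def vec_lambda_beta)
    finally show ?thesis using sum_Y by simp
  qed
  then show ?thesis by (simp add: vec_eq_iff)
qed

section \<open>Graphical designs are designs of the scheme\<close>

theorem lemma6p5:
  fixes R :: "nat \<Rightarrow> ('x::finite \<times> 'x) set"
    and J :: "nat \<Rightarrow> real ^ 'x ^ 'x"
    and s k :: nat and I :: "nat set" and Y :: "'x set"
  assumes "symmetric_association_scheme s R"
    and "primitive_idempotent_basis s R J"
    and "I \<subseteq> {1..s}" and "I \<noteq> {}"
    and "graph_connected (\<Union>i\<in>I. R i)"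
    and "graphical_design (\<Union>i\<in>I. R i) k Y"
  shows "\<exists>T. T_design s J T Y \<and> int (card T) \<ge> int k - 1"
proof -
  define L where "L = laplacian (\<Union>i\<in>I. R i)"
  have "I \<subseteq> {0..s}" using assms(3) by auto
  then have "L \<in> scheme_algebra s R"
    unfolding L_def by (rule laplacian_in_scheme_algebra[OF assms(1)])
  then have "\<exists>c. L ** J i = c *\<^sub>R J i \<and> J i ** L = c *\<^sub>R J i" if "i \<le> s" for i
    using scheme_algebra_mult_idempotent[OF assms(2)] that by blast
  then obtain c where c: "L ** J i = c i *\<^sub>R J i" "J i ** L = c i *\<^sub>R J i" if "i \<le> s" for i
    by metis
  obtain ls where Y: "Y \<noteq> {}" and ls: "distinct ls" "set ls = {\<mu>. eigenvalue L \<mu>}" "k \<le> length ls"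
    and int: "\<And>j. j < k \<Longrightarrow> integrates_space Y (eigenspace L (ls ! j))"
    using assms(6) by (auto simp: graphical_design_def frequency_ordering_def L_def)
  define T where "T = {i \<in> {1..s}. c i \<in> (!) ls ` {..<k}}"
  have "T_design s J T Y"
    unfolding T_design_def
  proof (intro conjI ballI)
    fix i assume "i \<in> T"
    then obtain j where j: "i \<in> {1..s}" "j < k" "c i = ls ! j" by (auto simp: T_def)
    then show "J i *v indicator_vec Y = 0"
      using c[of i] int[of j]
      by (intro idempotent_annihilates_indicator[OF assms(2) _ Y, where c = "c i"]) auto
  qed (use Y in \<open>auto simp: T_def\<close>)
  moreover have "k \<le> Suc (card T)"
  proof -
    have res: "(\<Sum>i\<in>{0..s}. J i) = mat 1"
      using assms(2) by (simp add: primitive_idempotent_basis_def)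
    \<comment> \<open>The index \<open>0\<close> may be the only source of one of the eigenvalues, namely of \<open>c 0\<close>; this
        accounts for the loss of one in the bound.\<close>
    have "(!) ls ` {..<k} \<subseteq> c ` insert 0 T"
    proof
      fix \<mu> assume \<mu>: "\<mu> \<in> (!) ls ` {..<k}"
      then have "\<mu> \<in> set ls" using ls(3) by auto
      then have "eigenvalue L \<mu>" using ls(2) by simp
      then have "\<mu> \<in> c ` {0..s}"
        using c(2) by (intro eigenvalue_of_resolution[OF res]) auto
      then obtain i where i: "i \<le> s" "\<mu> = c i" by auto
      with \<mu> have "i \<in> insert 0 T"
        by (cases "i = 0") (auto simp: T_def)
      with i show "\<mu> \<in> c ` insert 0 T" by blast
    qed
    moreover have "finite T" by (simp add: T_def)
    ultimately have "card ((!) ls ` {..<k}) \<le> card (insert 0 T)"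
      by (meson card_image_le card_mono finite_imageI finite_insert le_trans)
    moreover have "card ((!) ls ` {..<k}) = k"
      using ls(1,3) by (simp add: card_image inj_on_def nth_eq_iff_index_eq)
    ultimately show ?thesis
      using \<open>finite T\<close> by (simp add: T_def)
  qed
  ultimately show ?thesis by (intro exI[of _ T]) simp
qed

end
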